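(* Let $n\in\mathbb N$, $1<p<\infty$ and $p\le r\le\infty$. There is a constant $C>0$, independent of $p$ and of the functions $F,G$, such that for all $F,G\in L^{p,r}(\mathbb R^n)\cap\mathrm{BMO}(\mathbb R^n)$, $$\|F\cdot G\|_{L^p}\le C\,p^2\Big[\|F\|_{L^{p,r}}\|G\|_{\mathrm{BMO}}+\|G\|_{L^{p,r}}\|F\|_{\mathrm{BMO}}\Big].$$
   Context: $\mathbb R^n$ carries Lebesgue measure $m$. For a measurable function $f$ on $\mathbb R^n$, $d_f(\lambda)=m(\{x\in\mathbb R^n:|f(x)|>\lambda\})$ for $\lambda>0$ and $f^*(t)=\inf\{\lambda>0: d_f(\lambda)\le t\}$ for $t>0$ (the non-increasing rearrangement). For $1\le p<\infty$ and $1\le r\le\infty$, the Lorentz space $L^{p,r}(\mathbb R^n)$ is the set of measurable $f$ with $\|f\|_{L^{p,r}}<\infty$, where $\|f\|_{L^{p,r}}=\big(\int_0^\infty [s^{1/p}f^*(s)]^r\frac{ds}{s}\big)^{1/r}$ if $r<\infty$ and $\|f\|_{L^{p,\infty}}=\sup_{s>0}s^{1/p}f^*(s)$. $\mathrm{BMO}(\mathbb R^n)$ is the set of locally integrable $f$ with $\|f\|_{\mathrm{BMO}}=\sup_{B}\frac1{m(B)}\int_B|f(x)-f_B|\,dx<\infty$, the supremum being over all balls $B\subset\mathbb R^n$, with $f_B=\frac1{m(B)}\int_B f$. $\|\cdot\|_{L^p}$ is the usual Lebesgue norm on $\mathbb R^n$. *)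

theory Defs
  imports "HOL-Analysis.Analysis"
begin

text \<open>
  All norms take values in \<^typ>\<open>ennreal\<close>, so that finiteness is a genuine condition.
  Real powers of extended nonnegative numbers are used for exponents \<open>a > 0\<close> only, with
  \<open>\<infinity>\<^sup>a = \<infinity>\<close> and \<open>0\<^sup>a = 0\<close>.
\<close>

definition epowr :: "ennreal \<Rightarrow> real \<Rightarrow> ennreal" where
  "epowr x a = (if x = \<infinity> then \<infinity> else ennreal (enn2real x powr a))"

definition Lp_norm :: "real \<Rightarrow> ('a::euclidean_space \<Rightarrow> 'b::real_normed_vector) \<Rightarrow> ennreal" where
  "Lp_norm p f = epowr (\<integral>\<^sup>+x. ennreal (norm (f x) powr p) \<partial>lebesgue) (1 / p)"

definition distribution_fun :: "('a::euclidean_space \<Rightarrow> 'b::real_normed_vector) \<Rightarrow> real \<Rightarrow> ennreal" where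
  "distribution_fun f l = emeasure lebesgue {x. norm (f x) > l}"

text \<open>The infimum is taken in \<^typ>\<open>ennreal\<close>: over the empty set it is \<open>\<infinity>\<close>.\<close>

definition rearrangement :: "('a::euclidean_space \<Rightarrow> 'b::real_normed_vector) \<Rightarrow> real \<Rightarrow> ennreal" where
  "rearrangement f t = (INF l \<in> {l::real. l > 0 \<and> distribution_fun f l \<le> ennreal t}. ennreal l)"

definition lorentz_norm :: "real \<Rightarrow> ereal \<Rightarrow> ('a::euclidean_space \<Rightarrow> 'b::real_normed_vector) \<Rightarrow> ennreal" where
  "lorentz_norm p r f =
     (if r = \<infinity> then (SUP s \<in> {0<..}. ennreal (s powr (1 / p)) * rearrangement f s)
      else epowr
        (\<integral>\<^sup>+s \<in> {0<..}. epowr (ennreal (s powr (1 / p)) * rearrangement f s) (real_of_ereal r)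
            * ennreal (1 / s) \<partial>lborel)
        (1 / real_of_ereal r))"

definition lorentz_space :: "real \<Rightarrow> ereal \<Rightarrow> ('a::euclidean_space \<Rightarrow> 'b::real_normed_vector) set" where
  "lorentz_space p r = {f \<in> borel_measurable lebesgue. lorentz_norm p r f < \<infinity>}"

definition locally_integrable ::
    "('a::euclidean_space \<Rightarrow> 'b::{banach, second_countable_topology}) \<Rightarrow> bool" where
  "locally_integrable f \<longleftrightarrow> (\<forall>K. compact K \<longrightarrow> set_integrable lebesgue K f)"

definition ball_avg ::
    "('a::euclidean_space \<Rightarrow> 'b::{banach, second_countable_topology}) \<Rightarrow> 'a \<Rightarrow> real \<Rightarrow> 'b" where
  "ball_avg f x \<rho> = (LINT y : ball x \<rho> | lebesgue. f y) /\<^sub>R measure lebesgue (ball x \<rho>)"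

definition BMO_norm ::
    "('a::euclidean_space \<Rightarrow> 'b::{banach, second_countable_topology}) \<Rightarrow> ennreal" where
  "BMO_norm f = (SUP (x, \<rho>) \<in> UNIV \<times> {0<..}.
     (\<integral>\<^sup>+y \<in> ball x \<rho>. ennreal (norm (f y - ball_avg f x \<rho>)) \<partial>lebesgue)
       / emeasure lebesgue (ball x \<rho>))"

definition BMO :: "('a::euclidean_space \<Rightarrow> 'b::{banach, second_countable_topology}) set" where
  "BMO = {f. locally_integrable f \<and> BMO_norm f < \<infinity>}"

end

theory Submission
  imports Defs
begin

text \<open>
  Write \<open>A\<close>, \<open>a\<close> for the Lorentz and BMO norms of \<open>F\<close>, and \<open>B\<close>, \<open>b\<close> for those of \<open>G\<close>. The inequality
  follows from a bound on one function at a time,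
  \<open>(\<integral> norm F powr (2 * p)) powr (1 / p) \<le> C * p\<^sup>2 * A * a\<close>
  (lemma \<open>nn_integral_powr_double_le_lorentz_BMO\<close>), with \<open>C\<close> depending on the dimension only.
  By the Cauchy--Schwarz inequality (\<open>Lp_norm_mult_le\<close>), the \<open>L\<^sup>p\<close> norm of the product is then at most
  \<open>C * p\<^sup>2 * sqrt ((A * b) * (B * a))\<close>, and the geometric mean is at most \<open>A * b + B * a\<close>.

  The bound on one function interpolates between two estimates for the distribution function.
  For second exponent \<open>r \<ge> p\<close> the Lorentz norm controls the weak type,
  \<open>distribution_fun F l \<le> (4 * A / l) powr p\<close> (\<open>distribution_fun_le_lorentz_norm\<close>), which is used for
  levels below \<open>h = K * b'\<close> with \<open>b' > 0\<close> at least \<open>a\<close> and \<open>K\<close> a constant of the dimension.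
  Above \<open>h\<close>, raising the level by \<open>h\<close> divides the distribution function by \<open>4\<close>
  (\<open>distribution_fun_decay\<close>). This global version of the John--Nirenberg inequality is proved by
  covering a level set of finite measure by balls in which it has intermediate density.
\<close>

section \<open>Points of positive density\<close>

(* Left on, this rule would rewrite the density threshold 1/2 into inverse 2 and block the
   normalisation of products of real constants. *)
declare ennreal_half [simp del]

lemma open_emeasure_Int_ball_gt:
  fixes E :: "'a::euclidean_space set"
  assumes E [measurable]: "E \<in> sets lebesgue"
  shows "open {x. c < emeasure lebesgue (E \<inter> ball x \<rho>)}"
proof (subst open_contains_ball, safe)
  fix x assume x: "c < emeasure lebesgue (E \<inter> ball x \<rho>)"
  \<comment> \<open>Continuity from below: slightly smaller concentric balls already carry measure above \<open>c\<close>, and they stay inside \<open>ball y \<rho>\<close> for \<open>y\<close> near \<open>x\<close>.\<close>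
  let ?B = "\<lambda>k::nat. E \<inter> ball x (\<rho> - inverse (Suc k))"
  have U: "(\<Union>k. ?B k) = E \<inter> ball x \<rho>"
  proof (safe; simp)
    fix y :: 'a and k :: nat
    assume "dist x y < \<rho> - inverse (1 + real k)"
    moreover have "inverse (1 + real k) > 0" by simp
    ultimately show "dist x y < \<rho>" by linarith
  next
    fix y assume "dist x y < \<rho>"
    then obtain k where "inverse (real (Suc k)) < \<rho> - dist x y"
      using reals_Archimedean[of "\<rho> - dist x y"] by auto
    then show "\<exists>k. dist x y < \<rho> - inverse (1 + real k)"
      by (intro exI[of _ k]) (simp add: algebra_simps)
  qed
  have "(SUP k. emeasure lebesgue (?B k)) = emeasure lebesgue (\<Union>k. ?B k)"
  proof (rule SUP_emeasure_incseq)
    show "incseq ?B"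
    proof (rule incseq_SucI)
      fix k
      have "inverse (real (Suc (Suc k))) \<le> inverse (real (Suc k))"
        by (rule le_imp_inverse_le) auto
      then show "?B k \<le> ?B (Suc k)" by (intro Int_mono subset_ball) auto
    qed
  qed auto
  then have "c < (SUP k. emeasure lebesgue (?B k))" using x U by simp
  then obtain k where k: "c < emeasure lebesgue (?B k)" by (auto simp: less_SUP_iff)
  have "ball x (inverse (Suc k)) \<subseteq> {x. c < emeasure lebesgue (E \<inter> ball x \<rho>)}"
  proof safe
    fix y assume y: "y \<in> ball x (inverse (Suc k))"
    have "?B k \<subseteq> E \<inter> ball y \<rho>"
    proof (safe; simp)
      fix z assume "dist x z < \<rho> - inverse (1 + real k)"
      with y show "dist y z < \<rho>"
        using dist_triangle3[of y z x] by (simp add: dist_commute)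
    qed
    then have "emeasure lebesgue (?B k) \<le> emeasure lebesgue (E \<inter> ball y \<rho>)"
      by (intro emeasure_mono) auto
    with k show "c < emeasure lebesgue (E \<inter> ball y \<rho>)" by simp
  qed
  then show "\<exists>e>0. ball x e \<subseteq> {x. c < emeasure lebesgue (E \<inter> ball x \<rho>)}"
    by (intro exI[of _ "inverse (real (Suc k))"]) auto
qed

lemma emeasure_UN_countable_le:
  assumes C: "countable C" and X [measurable]: "\<And>i. i \<in> C \<Longrightarrow> X i \<in> sets M"
  shows "emeasure M (\<Union>i\<in>C. X i) \<le> (\<integral>\<^sup>+i. emeasure M (X i) \<partial>count_space C)"
proof -
  have "(\<Union>i\<in>C. X i) \<in> sets M" using C X by (intro sets.countable_UN') auto
  then have "emeasure M (\<Union>i\<in>C. X i) = (\<integral>\<^sup>+x. indicator (\<Union>i\<in>C. X i) x \<partial>M)" by simp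
  also have "\<dots> \<le> (\<integral>\<^sup>+x. \<integral>\<^sup>+i. indicator (X i) x \<partial>count_space C \<partial>M)"
  proof (rule nn_integral_mono)
    fix x
    show "indicator (\<Union>i\<in>C. X i) x \<le> (\<integral>\<^sup>+i. indicator (X i) x \<partial>count_space C)"
    proof (cases "x \<in> (\<Union>i\<in>C. X i)")
      case True
      then obtain j where j: "j \<in> C" "x \<in> X j" by blast
      then show ?thesis
        using nn_integral_ge_point[of j C "\<lambda>i. indicator (X i) x"]
        by (auto simp: indicator_def of_bool_def)
    qed simp
  qed
  also have "\<dots> = (\<integral>\<^sup>+i. \<integral>\<^sup>+x. indicator (X i) x \<partial>M \<partial>count_space C)"
    using C by (intro nn_integral_count_space_nn_integral) auto
  also have "\<dots> = (\<integral>\<^sup>+i. emeasure M (X i) \<partial>count_space C)"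
    by (intro nn_integral_cong) auto
  finally show ?thesis .
qed

lemma emeasure_UN_le_disjoint_UN:
  fixes X Y :: "'i \<Rightarrow> 'a::euclidean_space set"
  assumes C: "countable C"
    and X: "\<And>i. i \<in> C \<Longrightarrow> X i \<in> sets lebesgue" and Y: "\<And>i. i \<in> C \<Longrightarrow> Y i \<in> sets lebesgue"
    and disj: "disjoint_family_on Y C"
    and le: "\<And>i. i \<in> C \<Longrightarrow> emeasure lebesgue (X i) \<le> c * emeasure lebesgue (Y i)"
  shows "emeasure lebesgue (\<Union>i\<in>C. X i) \<le> c * emeasure lebesgue (\<Union>i\<in>C. Y i)"
proof -
  have "emeasure lebesgue (\<Union>i\<in>C. X i) \<le> (\<integral>\<^sup>+i. emeasure lebesgue (X i) \<partial>count_space C)"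
    using C X by (intro emeasure_UN_countable_le) auto
  also have "\<dots> \<le> (\<integral>\<^sup>+i. c * emeasure lebesgue (Y i) \<partial>count_space C)"
    by (intro nn_integral_mono) (auto intro: le)
  also have "\<dots> = c * (\<integral>\<^sup>+i. emeasure lebesgue (Y i) \<partial>count_space C)"
    by (rule nn_integral_cmult) auto
  also have "\<dots> = c * emeasure lebesgue (\<Union>i\<in>C. Y i)"
    using emeasure_UN_countable[OF _ C disj] Y by simp
  finally show ?thesis .
qed

text \<open>
  A weak form of the Lebesgue density theorem. If the exceptional set \<open>N\<close> had measure \<open>m > 0\<close>,
  cover it inside an open \<open>U \<supseteq> N\<close> of measure less than \<open>3/2 m\<close> by disjoint balls centred in
  \<open>N\<close>, up to a null set. As each of these balls is at most half filled,
  \<open>m \<le> 1/2 * 3/2 * m\<close>, a contradiction. Since the condition ranges over all radii, \<open>N\<close> is \<open>E\<close> minus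
  an open set and hence measurable.
\<close>

lemma negligible_low_density:
  fixes E :: "'a::euclidean_space set"
  assumes E [measurable]: "E \<in> sets lebesgue" and fin: "emeasure lebesgue E < \<infinity>"
  shows "negligible {x\<in>E. \<forall>\<rho>>0. emeasure lebesgue (E \<inter> ball x \<rho>) \<le> ennreal (1/2) * emeasure lebesgue (ball x \<rho>)}"
    (is "negligible ?N")
proof -
  define c where "c = (\<lambda>\<rho>. ennreal (1/2) * ennreal (unit_ball_vol DIM('a) * \<rho> ^ DIM('a)))"
  have N: "?N = E - (\<Union>\<rho>\<in>{0<..}. {x. c \<rho> < emeasure lebesgue (E \<inter> ball x \<rho>)})"
    by (auto simp: c_def emeasure_ball not_less)
  have "open (\<Union>\<rho>\<in>{0<..}. {x. c \<rho> < emeasure lebesgue (E \<inter> ball x \<rho>)})"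
    by (intro open_UN ballI open_emeasure_Int_ball_gt E)
  then have Nm0: "?N \<in> sets lebesgue"
    unfolding N by (intro sets.Diff E) (auto intro: lmeasurable_open borel_open)
  define N where "N = ?N"
  have Nm [measurable]: "N \<in> sets lebesgue" unfolding N_def by (rule Nm0)
  have NE: "N \<subseteq> E"
    and low: "\<And>x \<rho>. \<lbrakk>x \<in> N; 0 < \<rho>\<rbrakk> \<Longrightarrow>
      emeasure lebesgue (E \<inter> ball x \<rho>) \<le> ennreal (1/2) * emeasure lebesgue (ball x \<rho>)"
    by (auto simp: N_def)
  have Nfin: "emeasure lebesgue N < \<infinity>"
    using emeasure_mono[OF NE E] fin by (rule le_less_trans)
  define m where "m = measure lebesgue N"
  have m: "emeasure lebesgue N = ennreal m"
    unfolding m_def using Nfin by (intro emeasure_eq_ennreal_measure) auto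
  have m0: "0 \<le> m" unfolding m_def by simp
  have "m \<le> 0"
  proof (rule ccontr)
    assume "\<not> m \<le> 0"
    then have "m > 0" by simp
    obtain U where U: "open U" "N \<subseteq> U" "emeasure lebesgue (U - N) < ennreal (m/2)"
      by (rule sets_lebesgue_outer_open[OF Nm half_gt_zero[OF \<open>m > 0\<close>]])
    have Um [measurable]: "U \<in> sets lebesgue" using U(1) by auto
    have "emeasure lebesgue U = emeasure lebesgue N + emeasure lebesgue (U - N)"
      using U(2) by (subst plus_emeasure) (auto simp: Un_absorb1)
    also have "\<dots> < ennreal m + ennreal (m/2)"
      unfolding m using U(3) by (intro ennreal_add_left_cancel_less[THEN iffD2] conjI) auto
    finally have Ule: "emeasure lebesgue U < ennreal m + ennreal (m/2)" .
    define K where "K = {(x,\<rho>). x \<in> N \<and> 0 < \<rho> \<and> ball x \<rho> \<subseteq> U}"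
    obtain C where C: "countable C" "C \<subseteq> K"
      "pairwise (\<lambda>i j. disjnt (ball (fst i) (snd i)) (ball (fst j) (snd j))) C"
      "negligible (N - (\<Union>i\<in>C. ball (fst i) (snd i)))"
    proof (rule Vitali_covering_theorem_balls[of N K fst snd])
      fix x and d :: real assume x: "x \<in> N" and d: "0 < d"
      from x U obtain k where k: "k > 0" "ball x k \<subseteq> U" by (meson openE subsetD)
      have "ball x (min (d/2) k) \<subseteq> U" using k(2) by (auto simp: subset_iff)
      then show "\<exists>i. i \<in> K \<and> x \<in> ball (fst i) (snd i) \<and> snd i < d"
        using x d k by (intro exI[of _ "(x, min (d/2) k)"]) (auto simp: K_def)
    qed auto
    let ?B = "\<lambda>i. ball (fst i) (snd i)"
    have "emeasure lebesgue N \<le> emeasure lebesgue ((\<Union>i\<in>C. N \<inter> ?B i) \<union> (N - (\<Union>i\<in>C. ?B i)))"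
      using C(1) by (intro emeasure_mono sets.Un sets.Diff sets.countable_UN') auto
    also have "\<dots> = emeasure lebesgue (\<Union>i\<in>C. N \<inter> ?B i)"
      using C(1,4) by (intro emeasure_Un_null_set sets.countable_UN') (auto simp: negligible_iff_null_sets)
    also have "\<dots> \<le> ennreal (1/2) * emeasure lebesgue (\<Union>i\<in>C. ?B i)"
    proof (rule emeasure_UN_le_disjoint_UN[OF C(1)])
      show "disjoint_family_on ?B C"
        using C(3) by (auto simp: disjoint_family_on_def pairwise_def disjnt_def)
      fix i assume "i \<in> C"
      then have i: "fst i \<in> N" "0 < snd i" using C(2) by (auto simp: K_def)
      have "emeasure lebesgue (N \<inter> ?B i) \<le> emeasure lebesgue (E \<inter> ?B i)"
        using NE by (intro emeasure_mono) auto
      also have "\<dots> \<le> ennreal (1/2) * emeasure lebesgue (?B i)" using i by (rule low)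
      finally show "emeasure lebesgue (N \<inter> ?B i) \<le> ennreal (1/2) * emeasure lebesgue (?B i)" .
    qed auto
    also have "\<dots> \<le> ennreal (1/2) * emeasure lebesgue U"
      using C(2) by (intro mult_left_mono emeasure_mono) (fastforce simp: K_def subset_iff)+
    also have "\<dots> \<le> ennreal (1/2) * (ennreal m + ennreal (m/2))"
      using Ule by (intro mult_left_mono) auto
    also have "\<dots> = ennreal (3/4 * m)"
      using \<open>m > 0\<close> by (simp add: ennreal_plus[symmetric] ennreal_mult[symmetric] del: ennreal_plus)
    finally show False using \<open>m > 0\<close> m by simp
  qed
  with m0 m have "emeasure lebesgue N = 0" by simp
  then have "N \<in> null_sets lebesgue" using Nm by (intro null_setsI)
  then show ?thesis by (simp add: negligible_iff_null_sets N_def)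
qed

section \<open>Exponential decay of the distribution function\<close>

lemma sets_norm_gt:
  fixes f :: "'a::euclidean_space \<Rightarrow> 'b::real_normed_vector"
  assumes [measurable]: "f \<in> borel_measurable lebesgue"
  shows "{x. l < norm (f x)} \<in> sets lebesgue"
proof -
  have "{x \<in> space lebesgue. l < norm (f x)} \<in> sets lebesgue" by measurable
  then show ?thesis by simp
qed

text \<open>
  Doubling the radius until the density of \<open>E\<close> first drops to at most \<open>1/2\<close> keeps it above
  \<open>2\<^sup>-\<^sup>n\<^sup>-\<^sup>1\<close>. The doubling stops because \<open>E\<close> has finite measure.
\<close>

lemma intermediate_density_ball:
  fixes x :: "'a::euclidean_space"
  assumes E [measurable]: "E \<in> sets lebesgue" and fin: "emeasure lebesgue E < \<infinity>"
    and "0 < \<rho>" "ennreal (1/2) * emeasure lebesgue (ball x \<rho>) < emeasure lebesgue (E \<inter> ball x \<rho>)"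
  obtains \<sigma> where "0 < \<sigma>"
    "emeasure lebesgue (E \<inter> ball x \<sigma>) \<le> ennreal (1/2) * emeasure lebesgue (ball x \<sigma>)"
    "emeasure lebesgue (ball x \<sigma>) \<le> ennreal (2 ^ Suc DIM('a)) * emeasure lebesgue (E \<inter> ball x \<sigma>)"
proof -
  define V where "V = unit_ball_vol (real DIM('a))"
  have V: "V > 0" unfolding V_def by simp
  have ball: "emeasure lebesgue (ball x s) = ennreal (V * s ^ DIM('a))" if "s \<ge> 0" for s
    using that by (simp add: emeasure_ball V_def)
  define dense where "dense = (\<lambda>k::nat. ennreal (1/2) * emeasure lebesgue (ball x (\<rho> * 2 ^ k))
    < emeasure lebesgue (E \<inter> ball x (\<rho> * 2 ^ k)))"
  define e where "e = measure lebesgue E"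
  have e: "emeasure lebesgue E = ennreal e"
    unfolding e_def using fin by (intro emeasure_eq_ennreal_measure) auto
  have "\<exists>k. \<not> dense k"
  proof -
    obtain k where k: "2 * e / (V * \<rho> ^ DIM('a)) < 2 ^ k"
      using real_arch_pow[of 2 "2 * e / (V * \<rho> ^ DIM('a))"] by auto
    have pos: "0 < V * \<rho> ^ DIM('a)" using V \<open>0 < \<rho>\<close> by simp
    have "e < 1/2 * (V * \<rho> ^ DIM('a)) * 2 ^ k" using k pos by (simp add: field_simps)
    also have "\<dots> \<le> 1/2 * (V * \<rho> ^ DIM('a)) * (2 ^ k) ^ DIM('a)"
      using pos by (intro mult_left_mono self_le_power) auto
    also have "\<dots> = 1/2 * (V * (\<rho> * 2 ^ k) ^ DIM('a))" by (simp add: power_mult_distrib)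
    finally have "emeasure lebesgue E \<le> ennreal (1/2) * emeasure lebesgue (ball x (\<rho> * 2 ^ k))"
      using \<open>0 < \<rho>\<close> V unfolding e
      by (subst ball) (simp_all add: ennreal_mult[symmetric] ennreal_leI)
    moreover have "emeasure lebesgue (E \<inter> ball x (\<rho> * 2 ^ k)) \<le> emeasure lebesgue E"
      by (intro emeasure_mono) auto
    ultimately have "\<not> dense k" unfolding dense_def not_less by (rule order_trans[rotated])
    then show ?thesis ..
  qed
  moreover have "dense 0" using assms by (simp add: dense_def)
  ultimately obtain k where k: "dense k" "\<not> dense (Suc k)"
    using nat_induct[of dense] by blast
  define \<sigma> where "\<sigma> = \<rho> * 2 ^ Suc k"
  have s0: "0 < \<sigma>" using \<open>0 < \<rho>\<close> by (simp add: \<sigma>_def)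
  show thesis
  proof
    show "0 < \<sigma>" by fact
    show "emeasure lebesgue (E \<inter> ball x \<sigma>) \<le> ennreal (1/2) * emeasure lebesgue (ball x \<sigma>)"
      using k(2) unfolding dense_def \<sigma>_def by (simp only: not_less)
    have half: "\<rho> * 2 ^ k = \<sigma> / 2" by (simp add: \<sigma>_def)
    have "emeasure lebesgue (ball x \<sigma>) = ennreal (2 ^ Suc DIM('a)) * (ennreal (1/2) * emeasure lebesgue (ball x (\<sigma>/2)))"
      using s0 V by (subst (1 2) ball) (auto simp: ennreal_mult[symmetric] field_simps)
    also have "\<dots> \<le> ennreal (2 ^ Suc DIM('a)) * emeasure lebesgue (E \<inter> ball x (\<sigma>/2))"
      using k(1) unfolding dense_def half by (intro mult_left_mono) auto
    also have "\<dots> \<le> ennreal (2 ^ Suc DIM('a)) * emeasure lebesgue (E \<inter> ball x \<sigma>)"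
      using s0 by (intro mult_left_mono emeasure_mono) auto
    finally show "emeasure lebesgue (ball x \<sigma>) \<le> ennreal (2 ^ Suc DIM('a)) * emeasure lebesgue (E \<inter> ball x \<sigma>)" .
  qed
qed

lemma BMO_norm_ball_le:
  fixes f :: "'a::euclidean_space \<Rightarrow> 'b::{banach, second_countable_topology}"
  assumes "BMO_norm f \<le> ennreal b" "0 < \<rho>"
  shows "(\<integral>\<^sup>+y \<in> ball x \<rho>. ennreal (norm (f y - ball_avg f x \<rho>)) \<partial>lebesgue) \<le> ennreal b * emeasure lebesgue (ball x \<rho>)"
proof -
  let ?I = "\<integral>\<^sup>+y \<in> ball x \<rho>. ennreal (norm (f y - ball_avg f x \<rho>)) \<partial>lebesgue"
  have "?I / emeasure lebesgue (ball x \<rho>) \<le> BMO_norm f"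
    unfolding BMO_norm_def using assms(2) by (intro SUP_upper2[of "(x,\<rho>)"]) auto
  then have *: "?I / emeasure lebesgue (ball x \<rho>) \<le> ennreal b" using assms(1) by simp
  define m where "m = unit_ball_vol (real DIM('a)) * \<rho> ^ DIM('a)"
  have m: "m > 0" and e: "emeasure lebesgue (ball x \<rho>) = ennreal m"
    using assms(2) by (auto simp: m_def emeasure_ball)
  have "?I = ?I / ennreal m * ennreal m"
    using m by (simp add: ennreal_divide_times)
  also have "\<dots> \<le> ennreal b * ennreal m" using * unfolding e by (intro mult_right_mono) auto
  finally show ?thesis unfolding e .
qed

lemma set_nn_integral_ge_on_subset:
  assumes [measurable]: "u \<in> borel_measurable M" "S \<in> sets M" "Q \<in> sets M"
    and "S \<subseteq> Q" "\<And>y. y \<in> S \<Longrightarrow> c \<le> u y"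
    and "(\<integral>\<^sup>+y\<in>Q. ennreal (u y) \<partial>M) \<le> I"
  shows "ennreal c * emeasure M S \<le> I"
proof -
  have "ennreal c * emeasure M S = (\<integral>\<^sup>+y. ennreal c * indicator S y \<partial>M)"
    by (simp add: nn_integral_cmult_indicator)
  also have "\<dots> \<le> (\<integral>\<^sup>+y\<in>Q. ennreal (u y) \<partial>M)"
    using assms(4,5) by (intro nn_integral_mono) (auto simp: indicator_def intro!: ennreal_leI)
  also have "\<dots> \<le> I" by fact
  finally show ?thesis .
qed

text \<open>
  The multiple of the BMO norm by which the level is raised in order to divide the distribution
  function by \<open>4\<close> in dimension \<open>n\<close>. The first summand bounds how far the mean value over a dilated
  ball can exceed the level, and the second absorbs the covering constants.
\<close>

definition decay_const :: "nat \<Rightarrow> real" where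
  "decay_const n = 2 * 6 ^ n + 8 * 12 ^ n"

text \<open>
  As \<open>norm f \<le> l\<close> on at least half of the ball \<open>B\<close> of radius \<open>\<rho>\<close>, the average \<open>c\<close> of \<open>f\<close> over the
  six times larger ball \<open>Q\<close> satisfies \<open>norm c \<le> l + 2 * 6\<^sup>n * b\<close>. Hence \<open>norm f > l + decay_const n * b\<close> forces
  \<open>norm (f - c) \<ge> 8 * 12\<^sup>n * b\<close>, and Chebyshev's inequality on \<open>Q\<close> applies.
\<close>

lemma BMO_level_set_dilated_ball:
  fixes f :: "'a::euclidean_space \<Rightarrow> 'b::{banach, second_countable_topology}"
  assumes f [measurable]: "f \<in> borel_measurable lebesgue"
    and b: "BMO_norm f \<le> ennreal b" "0 < b" and "0 < \<rho>" and l: "0 \<le> l"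
    and low: "emeasure lebesgue ({y. l < norm (f y)} \<inter> ball x \<rho>) \<le> ennreal (1/2) * emeasure lebesgue (ball x \<rho>)"
  shows "emeasure lebesgue ({y. l + decay_const DIM('a) * b < norm (f y)} \<inter> ball x (6 * \<rho>))
    \<le> ennreal (1 / (8 * 2 ^ DIM('a))) * emeasure lebesgue (ball x \<rho>)"
proof -
  let ?n = "DIM('a)"
  define E where "E = {y. l < norm (f y)}"
  have [measurable]: "E \<in> sets lebesgue" unfolding E_def by (rule sets_norm_gt[OF f])
  note low = low[folded E_def]
  define V where "V = unit_ball_vol (real ?n) * \<rho> ^ ?n"
  have V: "V > 0" unfolding V_def using \<open>0 < \<rho>\<close> by simp
  have ball: "emeasure lebesgue (ball x \<rho>) = ennreal V"
    "emeasure lebesgue (ball x (6 * \<rho>)) = ennreal (6 ^ ?n * V)"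
    using \<open>0 < \<rho>\<close> by (auto simp: emeasure_ball V_def power_mult_distrib mult_ac)
  define c where "c = ball_avg f x (6 * \<rho>)"
  have osc: "(\<integral>\<^sup>+y \<in> ball x (6 * \<rho>). ennreal (norm (f y - c)) \<partial>lebesgue) \<le> ennreal (b * (6 ^ ?n * V))"
    using BMO_norm_ball_le[OF b(1), of "6 * \<rho>" x] \<open>0 < \<rho>\<close> b(2) V unfolding c_def[symmetric] ball
    by (simp add: ennreal_mult[symmetric])
  have avg: "norm c - l \<le> 2 * 6 ^ ?n * b"
  proof -
    let ?S = "ball x \<rho> - E \<inter> ball x \<rho>"
    have "emeasure lebesgue ?S = ennreal V - emeasure lebesgue (E \<inter> ball x \<rho>)"
      using low unfolding ball by (subst emeasure_Diff) (auto simp: ball top_unique ennreal_mult_eq_top_iff)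
    also have "\<dots> \<ge> ennreal V - ennreal (V/2)"
      using low V unfolding ball by (intro ennreal_minus_mono) (auto simp: ennreal_mult[symmetric])
    finally have S: "ennreal (V/2) \<le> emeasure lebesgue ?S" using V by (simp add: ennreal_minus)
    have "ennreal (norm c - l) * emeasure lebesgue ?S \<le> ennreal (b * (6 ^ ?n * V))"
    proof (rule set_nn_integral_ge_on_subset[OF _ _ _ _ _ osc])
      fix y assume "y \<in> ?S"
      then have "norm (f y) \<le> l" by (auto simp: E_def)
      then show "norm c - l \<le> norm (f y - c)"
        using norm_triangle_ineq2[of c "f y"] by (simp add: norm_minus_commute)
    qed (use \<open>0 < \<rho>\<close> in \<open>auto intro!: sets.Diff sets.Int\<close>)
    then have "ennreal (norm c - l) * ennreal (V/2) \<le> ennreal (b * (6 ^ ?n * V))"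
      using S by (meson mult_left_mono order_trans zero_le)
    moreover have "ennreal ((norm c - l) * (V/2)) = ennreal (norm c - l) * ennreal (V/2)"
      using V by (intro ennreal_mult'') simp
    ultimately have "ennreal ((norm c - l) * (V/2)) \<le> ennreal (b * (6 ^ ?n * V))"
      by simp
    then have "(norm c - l) * (V/2) \<le> b * (6 ^ ?n * V)" using b(2) V by (subst (asm) ennreal_le_iff) auto
    then have "V * (norm c - l) \<le> V * (2 * 6 ^ ?n * b)" by (simp add: algebra_simps)
    then show ?thesis using V by (simp only: mult_le_cancel_left_pos)
  qed
  define T where "T = {y. l + decay_const ?n * b < norm (f y)} \<inter> ball x (6 * \<rho>)"
  have [measurable]: "T \<in> sets lebesgue" unfolding T_def by (intro sets.Int sets_norm_gt[OF f]) auto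
  have "ennreal (8 * 12 ^ ?n * b) * emeasure lebesgue T \<le> ennreal (b * (6 ^ ?n * V))"
  proof (rule set_nn_integral_ge_on_subset[OF _ _ _ _ _ osc])
    fix y assume "y \<in> T"
    then have "l + decay_const ?n * b < norm (f y)" by (auto simp: T_def)
    then show "8 * 12 ^ ?n * b \<le> norm (f y - c)"
      using norm_triangle_ineq2[of "f y" c] avg by (simp add: decay_const_def algebra_simps)
  qed (use \<open>T \<in> sets lebesgue\<close> in \<open>auto simp: T_def\<close>)
  then have "ennreal (1 / (8 * 12 ^ ?n * b)) * (ennreal (8 * 12 ^ ?n * b) * emeasure lebesgue T)
     \<le> ennreal (1 / (8 * 12 ^ ?n * b)) * ennreal (b * (6 ^ ?n * V))" by (intro mult_left_mono) auto
  also have "ennreal (1 / (8 * 12 ^ ?n * b)) * (ennreal (8 * 12 ^ ?n * b) * emeasure lebesgue T) = emeasure lebesgue T"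
    using b(2) by (simp add: mult.assoc[symmetric] ennreal_mult[symmetric])
  also have "ennreal (1 / (8 * 12 ^ ?n * b)) * ennreal (b * (6 ^ ?n * V)) = ennreal (1 / (8 * 2 ^ ?n)) * ennreal V"
  proof -
    have "(12::real) ^ ?n = 6 ^ ?n * 2 ^ ?n" by (simp flip: power_mult_distrib)
    then have "1 / (8 * 12 ^ ?n * b) * (b * (6 ^ ?n * V)) = 1 / (8 * 2 ^ ?n) * V"
      using b(2) by simp
    then show ?thesis using b(2) V by (subst (1 2) ennreal_mult[symmetric]) auto
  qed
  finally show ?thesis unfolding ball T_def .
qed

text \<open>
  The global form of the John--Nirenberg inequality. Almost every point of \<open>E = {norm f > l}\<close> is the
  centre of a ball in which \<open>E\<close> has density between \<open>2\<^sup>-\<^sup>n\<^sup>-\<^sup>1\<close> and \<open>1/2\<close>. By Vitali's lemma, countably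
  many disjoint balls \<open>B\<close> among these have dilates covering almost all of \<open>E\<close>. The preceding lemma
  applies to each of them, and the measures of the sets \<open>E \<inter> B\<close> add up to at most that of \<open>E\<close>.
\<close>

lemma distribution_fun_decay:
  fixes f :: "'a::euclidean_space \<Rightarrow> 'b::{banach, second_countable_topology}"
  assumes f [measurable]: "f \<in> borel_measurable lebesgue"
    and b: "BMO_norm f \<le> ennreal b" "0 < b" and l: "0 \<le> l"
    and fin: "distribution_fun f l < \<infinity>"
  shows "distribution_fun f (l + decay_const DIM('a) * b) \<le> ennreal (1/4) * distribution_fun f l"
proof -
  let ?n = "DIM('a)"
  define E where "E = {y. l < norm (f y)}"
  define T where "T = {y. l + decay_const ?n * b < norm (f y)}"
  have [measurable]: "E \<in> sets lebesgue" "T \<in> sets lebesgue"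
    unfolding E_def T_def by (rule sets_norm_gt[OF f])+
  have "0 \<le> decay_const ?n * b" using b(2) by (simp add: decay_const_def)
  then have TE: "T \<subseteq> E" by (auto simp: T_def E_def)
  have fin: "emeasure lebesgue E < \<infinity>" using fin by (simp add: E_def distribution_fun_def)
  define N where "N = {x\<in>E. \<forall>\<rho>>0. emeasure lebesgue (E \<inter> ball x \<rho>) \<le> ennreal (1/2) * emeasure lebesgue (ball x \<rho>)}"
  have N: "N \<in> null_sets lebesgue"
    using negligible_low_density[OF _ fin] by (simp add: N_def negligible_iff_null_sets)
  define K where "K = {(x,\<sigma>). 0 < \<sigma> \<and>
    emeasure lebesgue (E \<inter> ball x \<sigma>) \<le> ennreal (1/2) * emeasure lebesgue (ball x \<sigma>) \<and>
    emeasure lebesgue (ball x \<sigma>) \<le> ennreal (2 ^ Suc ?n) * emeasure lebesgue (E \<inter> ball x \<sigma>)}"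
  have cover: "E - N \<subseteq> (\<Union>i\<in>K. cball (fst i) (snd i))"
  proof
    fix x assume "x \<in> E - N"
    then obtain \<rho> where "0 < \<rho>"
      "ennreal (1/2) * emeasure lebesgue (ball x \<rho>) < emeasure lebesgue (E \<inter> ball x \<rho>)"
      by (auto simp: N_def not_le)
    from intermediate_density_ball[OF _ fin this] obtain \<sigma> where "(x,\<sigma>) \<in> K" "0 < \<sigma>"
      unfolding K_def by auto
    then show "x \<in> (\<Union>i\<in>K. cball (fst i) (snd i))" by force
  qed
  define V where "V = unit_ball_vol (real ?n)"
  define e where "e = measure lebesgue E"
  have V: "V > 0" unfolding V_def by simp
  have e: "emeasure lebesgue E = ennreal e"
    unfolding e_def using fin by (intro emeasure_eq_ennreal_measure) auto
  have e0: "0 \<le> e" unfolding e_def by simp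
  \<comment> \<open>A ball of \<open>K\<close> has measure at most \<open>2\<^sup>n\<^sup>+\<^sup>1\<close> times that of \<open>E\<close>, which bounds its radius.\<close>
  have bounded: "0 < snd i \<and> snd i \<le> max 1 (2 ^ Suc ?n * e / V)" if i: "i \<in> K" for i
  proof -
    have "0 < snd i" using i by (auto simp: K_def)
    have "ennreal (V * snd i ^ ?n) = emeasure lebesgue (ball (fst i) (snd i))"
      using \<open>0 < snd i\<close> by (simp add: emeasure_ball V_def)
    also have "\<dots> \<le> ennreal (2 ^ Suc ?n) * emeasure lebesgue (E \<inter> ball (fst i) (snd i))"
      using i by (auto simp: K_def)
    also have "\<dots> \<le> ennreal (2 ^ Suc ?n) * emeasure lebesgue E"
      by (intro mult_left_mono emeasure_mono) auto
    finally have "V * snd i ^ ?n \<le> 2 ^ Suc ?n * e"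
      unfolding e using e0 by (simp add: ennreal_mult[symmetric] del: power_Suc)
    then have *: "snd i ^ ?n \<le> 2 ^ Suc ?n * e / V" using V by (simp add: field_simps)
    show ?thesis
    proof (cases "snd i \<le> 1")
      case False
      then have "snd i \<le> snd i ^ ?n" by (intro self_le_power) auto
      with * \<open>0 < snd i\<close> show ?thesis by linarith
    qed (use \<open>0 < snd i\<close> in auto)
  qed
  obtain C where C: "countable C" "C \<subseteq> K"
    "pairwise (\<lambda>i j. disjnt (cball (fst i) (snd i)) (cball (fst j) (snd j))) C"
    "E - N \<subseteq> (\<Union>i\<in>C. cball (fst i) (5 * snd i))"
    by (rule Vitali_covering_lemma_cballs[OF cover bounded])
  \<comment> \<open>Radius \<open>6 * snd i\<close> makes the open ball contain the closed ball of radius \<open>5 * snd i\<close>.\<close>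
  let ?B = "\<lambda>i. ball (fst i) (snd i)" and ?Q = "\<lambda>i. ball (fst i) (6 * snd i)"
  have disj: "disjoint_family_on ?B C"
    unfolding disjoint_family_on_def
  proof (intro ballI impI)
    fix i j assume "i \<in> C" "j \<in> C" "i \<noteq> j"
    then have "disjnt (cball (fst i) (snd i)) (cball (fst j) (snd j))"
      using C(3) by (auto simp: pairwise_def)
    then show "?B i \<inter> ?B j = {}" using ball_subset_cball unfolding disjnt_def by blast
  qed
  have "T \<subseteq> (\<Union>i\<in>C. T \<inter> ?Q i) \<union> N"
  proof
    fix x assume x: "x \<in> T"
    show "x \<in> (\<Union>i\<in>C. T \<inter> ?Q i) \<union> N"
    proof (cases "x \<in> N")
      case False
      with x TE C(4) obtain i where i: "i \<in> C" "x \<in> cball (fst i) (5 * snd i)" by blast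
      with C(2) have "0 < snd i" by (auto simp: K_def)
      with i x show ?thesis by force
    qed simp
  qed
  then have "emeasure lebesgue T \<le> emeasure lebesgue ((\<Union>i\<in>C. T \<inter> ?Q i) \<union> N)"
    using C(1) N by (intro emeasure_mono sets.Un sets.countable_UN') auto
  also have "\<dots> = emeasure lebesgue (\<Union>i\<in>C. T \<inter> ?Q i)"
    using C(1) N by (intro emeasure_Un_null_set sets.countable_UN') auto
  also have "\<dots> \<le> ennreal (1/4) * emeasure lebesgue (\<Union>i\<in>C. E \<inter> ?B i)"
  proof (rule emeasure_UN_le_disjoint_UN[OF C(1)])
    show "disjoint_family_on (\<lambda>i. E \<inter> ?B i) C"
      using disj unfolding disjoint_family_on_def by blast
    fix i assume "i \<in> C"
    then have i: "0 < snd i" "emeasure lebesgue (E \<inter> ?B i) \<le> ennreal (1/2) * emeasure lebesgue (?B i)"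
       "emeasure lebesgue (?B i) \<le> ennreal (2 ^ Suc ?n) * emeasure lebesgue (E \<inter> ?B i)"
      using C(2) by (auto simp: K_def)
    have "emeasure lebesgue (T \<inter> ?Q i) \<le> ennreal (1 / (8 * 2 ^ ?n)) * emeasure lebesgue (?B i)"
      unfolding T_def using i(2) unfolding E_def by (rule BMO_level_set_dilated_ball[OF f b i(1) l])
    also have "\<dots> \<le> ennreal (1 / (8 * 2 ^ ?n)) * (ennreal (2 ^ Suc ?n) * emeasure lebesgue (E \<inter> ?B i))"
      by (intro mult_left_mono i) auto
    also have "\<dots> = ennreal (1/4) * emeasure lebesgue (E \<inter> ?B i)"
      by (simp add: mult.assoc[symmetric] ennreal_mult[symmetric])
    finally show "emeasure lebesgue (T \<inter> ?Q i) \<le> ennreal (1/4) * emeasure lebesgue (E \<inter> ?B i)" .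
  qed auto
  also have "\<dots> \<le> ennreal (1/4) * emeasure lebesgue E"
    by (intro mult_left_mono emeasure_mono) auto
  finally show ?thesis by (simp add: T_def E_def distribution_fun_def)
qed

section \<open>The weak-type bound from the Lorentz norm\<close>

lemma epowr_ennreal: "0 \<le> x \<Longrightarrow> epowr (ennreal x) a = ennreal (x powr a)"
  by (simp add: epowr_def)

lemma epowr_mono:
  assumes "x \<le> y" "0 \<le> a"
  shows "epowr x a \<le> epowr y a"
proof (cases "y = \<infinity>")
  case False
  then have "y < \<infinity>" by (simp add: less_top)
  moreover from this assms(1) have "x < \<infinity>" by (rule le_less_trans[rotated])
  ultimately show ?thesis
    using assms enn2real_mono[of x y] by (auto simp: epowr_def intro!: ennreal_leI powr_mono2)
qed (simp add: epowr_def)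

lemma distribution_fun_antimono:
  fixes f :: "'a::euclidean_space \<Rightarrow> 'b::real_normed_vector"
  assumes "f \<in> borel_measurable lebesgue" "k \<le> l"
  shows "distribution_fun f l \<le> distribution_fun f k"
  unfolding distribution_fun_def using assms by (intro emeasure_mono sets_norm_gt) auto

lemma le_rearrangement:
  fixes f :: "'a::euclidean_space \<Rightarrow> 'b::real_normed_vector"
  assumes f: "f \<in> borel_measurable lebesgue" and s: "ennreal s < distribution_fun f l"
  shows "ennreal l \<le> rearrangement f s"
  unfolding rearrangement_def
proof (rule INF_greatest, clarify)
  fix k :: real assume "distribution_fun f k \<le> ennreal s"
  then have "l \<le> k" using distribution_fun_antimono[OF f, of k l] s by (meson leD le_cases order_trans)
  then show "ennreal l \<le> ennreal k" by (rule ennreal_leI)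
qed

text \<open>
  All spaces with second exponent \<open>r \<ge> p\<close> embed into the one with second exponent \<open>\<infinity>\<close>, with a
  constant independent of \<open>p\<close> and \<open>r\<close>. For finite \<open>r\<close> the rearrangement is at least \<open>l\<close> up to any
  \<open>s < distribution_fun f l\<close>, and it suffices to integrate over \<open>{s/2..s}\<close>.
\<close>

lemma distribution_fun_le_lorentz_norm:
  fixes f :: "'a::euclidean_space \<Rightarrow> 'b::real_normed_vector"
  assumes f: "f \<in> borel_measurable lebesgue" and p: "1 \<le> p" "ereal p \<le> r" and l: "0 < l"
    and A: "lorentz_norm p r f \<le> ennreal A" "0 \<le> A"
  shows "distribution_fun f l \<le> ennreal ((4 * A / l) powr p)"
proof -
  have key: "l * s powr (1 / p) \<le> 4 * A" if s: "0 < s" "ennreal s < distribution_fun f l" for s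
  proof (cases r)
    case PInf
    have "ennreal (s powr (1 / p) * l) = ennreal (s powr (1 / p)) * ennreal l"
      by (rule ennreal_mult') simp
    also have "\<dots> \<le> ennreal (s powr (1 / p)) * rearrangement f s"
      using le_rearrangement[OF f s(2)] by (intro mult_left_mono) auto
    also have "\<dots> \<le> lorentz_norm p r f"
      using s(1) PInf by (auto simp: lorentz_norm_def intro!: SUP_upper2[of s])
    also have "\<dots> \<le> ennreal A" by fact
    finally show ?thesis using A(2) by (simp add: mult.commute)
  next
    case (real q)
    with p have q: "1 \<le> q" "p \<le> q" by auto
    define c where "c = (s/2) powr (1 / p) * l"
    have c: "0 < c" using s l by (simp add: c_def)
    let ?I = "\<integral>\<^sup>+u \<in> {0<..}. epowr (ennreal (u powr (1 / p)) * rearrangement f u) q * ennreal (1 / u) \<partial>lborel"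
    have "ennreal (c powr q * (1 / s)) * emeasure lborel {s/2..s} =
        (\<integral>\<^sup>+u. ennreal (c powr q * (1 / s)) * indicator {s/2..s} u \<partial>lborel)"
      by (simp add: nn_integral_cmult_indicator)
    also have "\<dots> \<le> ?I"
    proof (rule nn_integral_mono)
      fix u :: real
      show "ennreal (c powr q * (1 / s)) * indicator {s/2..s} u
        \<le> epowr (ennreal (u powr (1 / p)) * rearrangement f u) q * ennreal (1 / u) * indicator {0<..} u"
      proof (cases "u \<in> {s/2..s}")
        case True
        with s have u: "0 < u" "s/2 \<le> u" "u \<le> s" by auto
        have "ennreal u < distribution_fun f l"
          using s(2) u(3) ennreal_leI le_less_trans by blast
        then have "ennreal l \<le> rearrangement f u" by (rule le_rearrangement[OF f])
        moreover have "(s/2) powr (1 / p) \<le> u powr (1 / p)"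
          using u s p by (intro powr_mono2) auto
        ultimately have "ennreal ((s/2) powr (1 / p)) * ennreal l
            \<le> ennreal (u powr (1 / p)) * rearrangement f u"
          by (intro mult_mono ennreal_leI) auto
        then have "epowr (ennreal c) q \<le> epowr (ennreal (u powr (1 / p)) * rearrangement f u) q"
          using q by (intro epowr_mono) (auto simp: c_def ennreal_mult')
        then have "ennreal (c powr q) * ennreal (1 / s)
            \<le> epowr (ennreal (u powr (1 / p)) * rearrangement f u) q * ennreal (1 / u)"
          using c u s by (intro mult_mono ennreal_leI) (auto simp: epowr_ennreal frac_le)
        moreover have "ennreal (c powr q) * ennreal (1 / s) = ennreal (c powr q * (1 / s))"
          by (rule ennreal_mult'[symmetric]) simp
        ultimately show ?thesis using True u by simp
      qed simp
    qed
    finally have I: "ennreal (c powr q / 2) \<le> ?I"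
      using s by (simp add: ennreal_mult''[symmetric])
    have "c / 2 \<le> c * (1/2) powr (1 / q)"
    proof -
      have "(1/2) powr 1 \<le> (1/2::real) powr (1 / q)"
        using q by (intro powr_mono') auto
      then show ?thesis using c by simp
    qed
    also have "\<dots> = (c powr q / 2) powr (1 / q)"
      using c q powr_mult[of "c powr q" "1/2" "1/q"] by (simp add: powr_powr)
    finally have "ennreal (c / 2) \<le> epowr (ennreal (c powr q / 2)) (1 / q)"
      by (subst epowr_ennreal) (auto intro: ennreal_leI)
    also have "\<dots> \<le> epowr ?I (1 / q)" using I q by (intro epowr_mono) auto
    also have "\<dots> = lorentz_norm p r f" using real by (simp add: lorentz_norm_def)
    also have "\<dots> \<le> ennreal A" by fact
    finally have "c / 2 \<le> A" using A(2) by simp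
    moreover have "s powr (1 / p) / 2 \<le> (s/2) powr (1 / p)"
    proof -
      have "(1/2) powr 1 \<le> (1/2::real) powr (1 / p)"
        using p by (intro powr_mono') auto
      then show ?thesis
        using s powr_mult[of s "1/2" "1/p"] mult_left_mono[of "1/2" "(1/2) powr (1/p)" "s powr (1/p)"] by simp
    qed
    then have "s powr (1 / p) / 2 * l \<le> c" unfolding c_def using l by (intro mult_right_mono) auto
    ultimately show ?thesis by (simp add: mult.commute)
  qed (use p in auto)
  show ?thesis
  proof (rule dense_le)
    fix x assume x: "x < distribution_fun f l"
    then have "x < \<infinity>" using less_le_trans top_greatest by fastforce
    then obtain s where s: "x = ennreal s" "0 \<le> s" by (cases x) auto
    show "x \<le> ennreal ((4 * A / l) powr p)"
    proof (cases "s = 0")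
      case False
      with s have "0 < s" by simp
      then have "s powr (1 / p) \<le> 4 * A / l" using key x s l by (simp add: field_simps)
      then have "(s powr (1 / p)) powr p \<le> (4 * A / l) powr p" using p by (intro powr_mono2) auto
      then show ?thesis using \<open>0 < s\<close> p s by (auto simp: powr_powr intro: ennreal_leI)
    qed (use s in simp)
  qed
qed

section \<open>Interpolation between the weak type and BMO\<close>

lemma dyadic_layer:
  fixes t h :: real
  assumes "0 < t" "t \<le> h"
  obtains j :: nat where "h / 2 ^ Suc j < t" "t \<le> h / 2 ^ j"
proof -
  obtain k where "h / t < 2 ^ k" using real_arch_pow[of 2 "h / t"] by auto
  then have "\<exists>k. h / 2 ^ k < t" using assms by (intro exI[of _ k]) (simp add: field_simps)
  moreover have "\<not> h / 2 ^ 0 < t" using assms by simp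
  ultimately obtain j where "h / 2 ^ Suc j < t" "\<not> h / 2 ^ j < t"
    using nat_induct[of "\<lambda>k. \<not> h / 2 ^ k < t"] by blast
  then show thesis using that by (simp add: not_less)
qed

lemma arithmetic_layer:
  fixes t h :: real
  assumes "0 < h" "h < t"
  obtains k :: nat where "h + real k * h < t" "t \<le> (real k + 2) * h"
proof -
  define k where "k = nat (\<lceil>t / h\<rceil> - 2)"
  have "1 < t / h" using assms by simp
  then have "2 \<le> \<lceil>t / h\<rceil>" by linarith
  then have k: "real k = real_of_int \<lceil>t / h\<rceil> - 2" by (simp add: k_def)
  then have "real k + 1 < t / h" "t / h \<le> real k + 2" by linarith+
  then show thesis using assms by (intro that[of k]) (auto simp: field_simps)
qed

lemma ennreal_le_suminf: "f j \<le> (\<Sum>j. f j :: ennreal)"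
  using sum_le_suminf[OF summableI, of "{j}" f] by simp

lemma powr_le_layers:
  fixes t h q :: real
  assumes "0 \<le> t" "0 < h" "0 < q"
  shows "ennreal (t powr q) \<le>
    (\<Sum>j. ennreal ((h / 2 ^ j) powr q) * indicator {h / 2 ^ Suc j<..} t) +
    (\<Sum>k. ennreal (((real k + 2) * h) powr q) * indicator {h + real k * h<..} t)"
    (is "_ \<le> ?L + ?U")
proof (cases "t \<le> h")
  case True
  show ?thesis
  proof (cases "t = 0")
    case False
    with assms True obtain j :: nat where j: "h / 2 ^ Suc j < t" "t \<le> h / 2 ^ j"
      using dyadic_layer[of t h] by auto
    then have "ennreal (t powr q) \<le> ennreal ((h / 2 ^ j) powr q) * indicator {h / 2 ^ Suc j<..} t"
      using assms by (auto intro!: ennreal_leI powr_mono2)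
    also have "\<dots> \<le> ?L" by (rule ennreal_le_suminf)
    also have "\<dots> \<le> ?L + ?U" by simp
    finally show ?thesis .
  qed simp
next
  case False
  with assms obtain k :: nat where k: "h + real k * h < t" "t \<le> (real k + 2) * h"
    using arithmetic_layer[of h t] by auto
  then have "ennreal (t powr q) \<le> ennreal (((real k + 2) * h) powr q) * indicator {h + real k * h<..} t"
    using assms by (auto intro!: ennreal_leI powr_mono2)
  also have "\<dots> \<le> ?U" by (rule ennreal_le_suminf[of "\<lambda>k. _ k"])
  also have "\<dots> \<le> ?L + ?U" by simp
  finally show ?thesis .
qed

lemma suminf_geometric_half:
  assumes "0 \<le> c" shows "(\<Sum>k. ennreal (c * (1/2) ^ k)) = ennreal (2 * c)"
proof (rule suminf_ennreal_eq)
  show "(\<lambda>k. c * (1/2) ^ k) sums (2 * c)"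
    using sums_mult[OF geometric_sums[of "1/2::real"], of c] by (simp add: mult.commute)
qed (use assms in simp)

lemma powr_double_mult:
  fixes x y p :: real
  assumes "0 < x" "0 \<le> y"
  shows "x powr (2 * p) * y powr p = (x\<^sup>2 * y) powr p"
proof -
  have "x powr (2 * p) = (x\<^sup>2) powr p"
    using assms(1) by (simp add: powr_powr flip: powr_numeral)
  then show ?thesis
    using assms by (simp add: powr_mult)
qed

text \<open>
  Growth \<open>m\<^sup>2\<^sup>p\<close> of the layers is dominated by \<open>2\<^sup>m\<close>, which the decay \<open>4\<^sup>-\<^sup>m\<close> absorbs. The cost
  \<open>(4 p)\<^sup>2\<^sup>p\<close> is the only source of the factor \<open>p\<^sup>2\<close> in the theorem.
\<close>

lemma powr_double_le_exponential:
  fixes p :: real and m :: nat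
  assumes p: "1 \<le> p"
  shows "real m powr (2 * p) \<le> (4 * p) powr (2 * p) * 2 ^ m"
proof -
  define y where "y = real m / (4 * p)"
  have m: "real m = 4 * p * y" and y: "0 \<le> y" using p by (simp_all add: y_def)
  have "y \<le> exp y" using exp_ge_add_one_self[of y] by linarith
  then have "real m \<le> 4 * p * exp y" unfolding m using p by (intro mult_left_mono) auto
  then have "real m powr (2 * p) \<le> (4 * p * exp y) powr (2 * p)"
    using p by (intro powr_mono2) auto
  also have "\<dots> = (4 * p) powr (2 * p) * exp (y * (2 * p))"
    using p by (simp only: powr_mult exp_powr_real)
  also have "y * (2 * p) = real m * (1/2)" using m by simp
  also have "exp (real m * (1/2)) = exp (1/2) ^ m"
    by (rule exp_of_nat_mult)
  also have "(4 * p) powr (2 * p) * exp (1/2) ^ m \<le> (4 * p) powr (2 * p) * 2 ^ m"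
    by (rule mult_left_mono[OF power_mono[OF exp_half_le2]]) simp_all
  finally show ?thesis .
qed

text \<open>
  Values of \<open>norm f\<close> below \<open>h\<close> are sorted into the dyadic layers \<open>(h / 2\<^sup>j\<^sup>+\<^sup>1, h / 2\<^sup>j]\<close> and controlled
  by the weak-type bound. Those above \<open>h\<close> are sorted into layers of height \<open>h\<close> and controlled by the decay.
\<close>

lemma nn_integral_powr_double_le:
  fixes f :: "'a::euclidean_space \<Rightarrow> 'b::real_normed_vector"
  assumes f [measurable]: "f \<in> borel_measurable lebesgue"
    and p: "1 \<le> p" and h: "0 < h" and A: "0 \<le> A"
    and weak: "\<And>l. 0 < l \<Longrightarrow> distribution_fun f l \<le> ennreal ((A / l) powr p)"
    and decay: "\<And>l. 0 < l \<Longrightarrow> distribution_fun f (l + h) \<le> ennreal (1/4) * distribution_fun f l"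
  shows "(\<integral>\<^sup>+x. ennreal (norm (f x) powr (2 * p)) \<partial>lebesgue) \<le> ennreal ((160 * p\<^sup>2 * A * h) powr p)"
proof -
  let ?d = "distribution_fun f"
  have int: "(\<integral>\<^sup>+x. c * indicator {l<..} (norm (f x)) \<partial>lebesgue) = c * ?d l" for c l
  proof -
    have "(\<integral>\<^sup>+x. c * indicator {l<..} (norm (f x)) \<partial>lebesgue) = (\<integral>\<^sup>+x. c * indicator {x. l < norm (f x)} x \<partial>lebesgue)"
      by (intro nn_integral_cong) (auto simp: indicator_def)
    then show ?thesis
      unfolding distribution_fun_def by (simp add: nn_integral_cmult_indicator sets_norm_gt[OF f])
  qed
  have meas [measurable]: "(\<lambda>x. c * indicator {l<..} (norm (f x))) \<in> borel_measurable lebesgue" for c :: ennreal and l :: real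
    by measurable
  have "(\<integral>\<^sup>+x. ennreal (norm (f x) powr (2 * p)) \<partial>lebesgue) \<le>
    (\<integral>\<^sup>+x. (\<Sum>j. ennreal ((h / 2 ^ j) powr (2 * p)) * indicator {h / 2 ^ Suc j<..} (norm (f x))) +
    (\<Sum>k. ennreal (((real k + 2) * h) powr (2 * p)) * indicator {h + real k * h<..} (norm (f x))) \<partial>lebesgue)"
    using p h by (intro nn_integral_mono powr_le_layers) auto
  also have "\<dots> = (\<Sum>j. ennreal ((h / 2 ^ j) powr (2 * p)) * ?d (h / 2 ^ Suc j)) +
    (\<Sum>k. ennreal (((real k + 2) * h) powr (2 * p)) * ?d (h + real k * h))"
    by (subst nn_integral_add) (auto simp: nn_integral_suminf int simp del: power_Suc)
  also have "\<dots> \<le> ennreal (2 * (2 * A * h) powr p) + ennreal (2 * (4 * (16 * p\<^sup>2 * A * h) powr p))"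
  proof (rule add_mono)
    have "(\<Sum>j. ennreal ((h / 2 ^ j) powr (2 * p)) * ?d (h / 2 ^ Suc j)) \<le> (\<Sum>j. ennreal ((2 * A * h) powr p * (1/2) ^ j))"
    proof (intro suminf_le summableI)
      fix j :: nat
      have "ennreal ((h / 2 ^ j) powr (2 * p)) * ?d (h / 2 ^ Suc j)
        \<le> ennreal ((h / 2 ^ j) powr (2 * p)) * ennreal ((A / (h / 2 ^ Suc j)) powr p)"
        using h by (intro mult_left_mono weak) auto
      also have "\<dots> = ennreal (((h / 2 ^ j)\<^sup>2 * (A / (h / 2 ^ Suc j))) powr p)"
        using h A by (subst powr_double_mult[symmetric]) (simp_all add: ennreal_mult' del: power_Suc)
      also have "(h / 2 ^ j)\<^sup>2 * (A / (h / 2 ^ Suc j)) = 2 * A * h * (1/2) ^ j"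
        using h by (simp add: field_simps power2_eq_square)
      also have "(2 * A * h * (1/2) ^ j) powr p = (2 * A * h) powr p * ((1/2) ^ j) powr p"
        using h A by (simp add: powr_mult)
      also have "ennreal \<dots> \<le> ennreal ((2 * A * h) powr p * (1/2) ^ j)"
      proof (intro ennreal_leI mult_left_mono)
        show "((1/2::real) ^ j) powr p \<le> (1/2) ^ j"
          using powr_mono'[of 1 p "(1/2::real) ^ j"] p by (simp add: power_le_one)
      qed auto
      finally show "ennreal ((h / 2 ^ j) powr (2 * p)) * ?d (h / 2 ^ Suc j) \<le> ennreal ((2 * A * h) powr p * (1/2) ^ j)" .
    qed
    then show "(\<Sum>j. ennreal ((h / 2 ^ j) powr (2 * p)) * ?d (h / 2 ^ Suc j)) \<le> ennreal (2 * (2 * A * h) powr p)"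
      by (subst (asm) suminf_geometric_half) auto
  next
    \<comment> \<open>The decay starts at level \<open>h\<close>, where the weak-type bound applies.\<close>
    have dk: "?d (h + real k * h) \<le> ennreal ((1/4) ^ k * (A / h) powr p)" for k
    proof (induction k)
      case 0
      then show ?case using weak[OF h] by simp
    next
      case (Suc k)
      have "?d (h + real (Suc k) * h) = ?d ((h + real k * h) + h)" by (simp add: algebra_simps)
      also have "\<dots> \<le> ennreal (1/4) * ?d (h + real k * h)" using h by (intro decay) (simp add: add_pos_nonneg)
      also have "\<dots> \<le> ennreal (1/4) * ennreal ((1/4) ^ k * (A / h) powr p)"
        using Suc.IH by (rule mult_left_mono) simp
      also have "\<dots> = ennreal ((1/4) ^ Suc k * (A / h) powr p)"
        by (simp add: ennreal_mult'[symmetric] mult.assoc)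
      finally show ?case .
    qed
    have "(\<Sum>k. ennreal (((real k + 2) * h) powr (2 * p)) * ?d (h + real k * h)) \<le> (\<Sum>k. ennreal (4 * (16 * p\<^sup>2 * A * h) powr p * (1/2) ^ k))"
    proof (intro suminf_le summableI)
      fix k :: nat
      have k: "(real k + 2) powr (2 * p) \<le> (4 * p) powr (2 * p) * 2 ^ (k + 2)"
        using powr_double_le_exponential[OF p, of "k + 2"] by (simp add: add.commute)
      have "((real k + 2) * h) powr (2 * p) = (real k + 2) powr (2 * p) * h powr (2 * p)"
        using h by (simp add: powr_mult)
      also have "\<dots> \<le> (4 * p) powr (2 * p) * 2 ^ (k + 2) * h powr (2 * p)"
        using k by (rule mult_right_mono) simp
      finally have kh: "ennreal (((real k + 2) * h) powr (2 * p)) \<le> ennreal ((4 * p) powr (2 * p) * 2 ^ (k + 2) * h powr (2 * p))"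
        by (rule ennreal_leI)
      have "ennreal (((real k + 2) * h) powr (2 * p)) * ?d (h + real k * h)
        \<le> ennreal ((4 * p) powr (2 * p) * 2 ^ (k + 2) * h powr (2 * p)) * ennreal ((1/4) ^ k * (A / h) powr p)"
        by (rule mult_mono[OF kh dk]) simp_all
      also have "\<dots> = ennreal ((2 ^ (k + 2) * (1/4) ^ k) * ((4 * p * h) powr (2 * p) * (A / h) powr p))"
        using p h by (simp add: ennreal_mult'[symmetric] powr_mult mult_ac)
      also have "(4 * p * h) powr (2 * p) * (A / h) powr p = ((4 * p * h)\<^sup>2 * (A / h)) powr p"
        using A h p by (intro powr_double_mult) auto
      also have "(4 * p * h)\<^sup>2 * (A / h) = 16 * p\<^sup>2 * A * h"
        using h by (simp add: power2_eq_square)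
      also have "(2::real) ^ (k + 2) * (1/4) ^ k = 4 * (1/2) ^ k"
      proof -
        have "(2::real) ^ k * (1/4) ^ k = (1/2) ^ k" by (simp flip: power_mult_distrib)
        then show ?thesis by (simp add: power_add)
      qed
      also have "4 * (1/2) ^ k * (16 * p\<^sup>2 * A * h) powr p = 4 * (16 * p\<^sup>2 * A * h) powr p * (1/2) ^ k"
        by simp
      finally show "ennreal (((real k + 2) * h) powr (2 * p)) * ?d (h + real k * h)
        \<le> ennreal (4 * (16 * p\<^sup>2 * A * h) powr p * (1/2) ^ k)" .
    qed
    then show "(\<Sum>k. ennreal (((real k + 2) * h) powr (2 * p)) * ?d (h + real k * h)) \<le> ennreal (2 * (4 * (16 * p\<^sup>2 * A * h) powr p))"
      by (subst (asm) suminf_geometric_half) auto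
  qed
  also have "\<dots> = ennreal (2 * (2 * A * h) powr p + 8 * (16 * p\<^sup>2 * A * h) powr p)" by simp
  also have "\<dots> \<le> ennreal ((160 * p\<^sup>2 * A * h) powr p)"
  proof (rule ennreal_leI)
    have "1 \<le> p\<^sup>2" using p by simp
    then have "2 * A * h \<le> 16 * p\<^sup>2 * A * h"
      using A h by (intro mult_right_mono) auto
    then have "(2 * A * h) powr p \<le> (16 * p\<^sup>2 * A * h) powr p"
      using A h p by (intro powr_mono2) auto
    then have "2 * (2 * A * h) powr p + 8 * (16 * p\<^sup>2 * A * h) powr p \<le> 10 * (16 * p\<^sup>2 * A * h) powr p" by simp
    also have "\<dots> \<le> 10 powr p * (16 * p\<^sup>2 * A * h) powr p"
      using powr_mono[of 1 p "10::real"] p by (intro mult_right_mono) auto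
    also have "\<dots> = (10 * (16 * p\<^sup>2 * A * h)) powr p"
      by (rule powr_mult[symmetric])
    also have "10 * (16 * p\<^sup>2 * A * h) = 160 * p\<^sup>2 * A * h" by simp
    finally show "2 * (2 * A * h) powr p + 8 * (16 * p\<^sup>2 * A * h) powr p \<le> (160 * p\<^sup>2 * A * h) powr p" .
  qed
  finally show ?thesis .
qed

text \<open>
  The preceding lemma needs a positive step \<open>h\<close>, so it is applied with \<open>b > 0\<close>, \<open>b \<ge> a\<close> in place of
  the BMO norm \<open>a\<close>. Letting \<open>b\<close> tend to \<open>a\<close> covers the case \<open>a = 0\<close>.
\<close>

lemma nn_integral_powr_double_le_lorentz_BMO:
  fixes f :: "'a::euclidean_space \<Rightarrow> 'b::{banach, second_countable_topology}"
  assumes f: "f \<in> borel_measurable lebesgue" and p: "1 \<le> p" "ereal p \<le> r"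
    and A: "lorentz_norm p r f = ennreal A" "0 \<le> A"
    and a: "BMO_norm f = ennreal a" "0 \<le> a"
  shows "(\<integral>\<^sup>+x. ennreal (norm (f x) powr (2 * p)) \<partial>lebesgue)
    \<le> ennreal ((640 * decay_const DIM('a) * p\<^sup>2 * A * a) powr p)"
proof -
  let ?K = "decay_const DIM('a)"
  have K: "0 < ?K" by (simp add: decay_const_def add_pos_pos)
  have bound: "(\<integral>\<^sup>+x. ennreal (norm (f x) powr (2 * p)) \<partial>lebesgue)
    \<le> ennreal ((640 * ?K * p\<^sup>2 * A * b) powr p)" if b: "a \<le> b" "0 < b" for b
  proof -
    have weak: "distribution_fun f l \<le> ennreal ((4 * A / l) powr p)" if "0 < l" for l
      using distribution_fun_le_lorentz_norm[OF f p that] A by simp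
    have "BMO_norm f \<le> ennreal b" using a b by (simp add: ennreal_leI)
    have "(\<integral>\<^sup>+x. ennreal (norm (f x) powr (2 * p)) \<partial>lebesgue)
      \<le> ennreal ((160 * p\<^sup>2 * (4 * A) * (?K * b)) powr p)"
    proof (rule nn_integral_powr_double_le[OF f p(1)])
      fix l :: real assume l: "0 < l"
      have "distribution_fun f l < \<infinity>" using weak[OF l] by (simp add: le_less_trans)
      then show "distribution_fun f (l + ?K * b) \<le> ennreal (1/4) * distribution_fun f l"
        using l b(2) by (intro distribution_fun_decay[OF f \<open>BMO_norm f \<le> ennreal b\<close>]) auto
    qed (use weak A K b in auto)
    then show ?thesis by (simp add: mult_ac)
  qed
  have "(\<lambda>k. a + inverse (real (Suc k))) \<longlonglongrightarrow> a + 0"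
    by (intro tendsto_intros LIMSEQ_inverse_real_of_nat)
  then have lim: "(\<lambda>k. 640 * ?K * p\<^sup>2 * A * (a + inverse (real (Suc k)))) \<longlonglongrightarrow> 640 * ?K * p\<^sup>2 * A * a"
    by (intro tendsto_mult_left) simp
  have "(\<lambda>k. ennreal ((640 * ?K * p\<^sup>2 * A * (a + inverse (real (Suc k)))) powr p))
      \<longlonglongrightarrow> ennreal ((640 * ?K * p\<^sup>2 * A * a) powr p)"
    using p K A a by (intro tendsto_ennrealI tendsto_powr'[OF lim tendsto_const]) auto
  then show ?thesis
    by (rule LIMSEQ_le_const) (intro exI allI impI bound, use a in \<open>auto intro: add_nonneg_pos\<close>)
qed

section \<open>The product estimate\<close>

lemma ennreal_power2_le_imp_le:
  assumes "x\<^sup>2 \<le> (ennreal y)\<^sup>2" "0 \<le> y"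
  shows "x \<le> ennreal y"
proof (cases x)
  case (real a)
  with assms have "a\<^sup>2 \<le> y\<^sup>2" by (simp add: ennreal_power)
  then have "a \<le> y" using assms(2) by (rule power2_le_imp_le)
  with real show ?thesis by (simp add: ennreal_leI)
next
  case top
  with assms show ?thesis by (simp add: ennreal_power top_unique)
qed

lemma Lp_norm_mult_le:
  fixes F G :: "'a::euclidean_space \<Rightarrow> 'b::real_normed_div_algebra"
  assumes F [measurable]: "F \<in> borel_measurable lebesgue" and G [measurable]: "G \<in> borel_measurable lebesgue"
    and p: "0 < p" and XY: "0 \<le> X" "0 \<le> Y"
    and FX: "(\<integral>\<^sup>+x. ennreal (norm (F x) powr (2 * p)) \<partial>lebesgue) \<le> ennreal (X powr p)"
    and GY: "(\<integral>\<^sup>+x. ennreal (norm (G x) powr (2 * p)) \<partial>lebesgue) \<le> ennreal (Y powr p)"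
  shows "Lp_norm p (\<lambda>x. F x * G x) \<le> ennreal (sqrt (X * Y))"
proof -
  have sq: "(ennreal (u powr p))\<^sup>2 = ennreal (u powr (2 * p))" for u
    by (simp add: power2_eq_square ennreal_mult'[symmetric] powr_add[symmetric])
  let ?I = "\<integral>\<^sup>+x. ennreal (norm (F x * G x) powr p) \<partial>lebesgue"
  have "?I\<^sup>2 = (\<integral>\<^sup>+x. ennreal (norm (F x) powr p) * ennreal (norm (G x) powr p) \<partial>lebesgue)\<^sup>2"
    by (simp add: norm_mult powr_mult ennreal_mult')
  also have "\<dots> \<le> (\<integral>\<^sup>+x. (ennreal (norm (F x) powr p))\<^sup>2 \<partial>lebesgue) * (\<integral>\<^sup>+x. (ennreal (norm (G x) powr p))\<^sup>2 \<partial>lebesgue)"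
    by (rule Cauchy_Schwarz_nn_integral) measurable
  also have "\<dots> \<le> ennreal (X powr p) * ennreal (Y powr p)"
    unfolding sq by (intro mult_mono FX GY) auto
  also have "\<dots> = (ennreal (sqrt (X * Y) powr p))\<^sup>2"
    using XY by (simp add: ennreal_mult'[symmetric] ennreal_power power2_eq_square powr_mult[symmetric])
  finally have "?I \<le> ennreal (sqrt (X * Y) powr p)"
    by (rule ennreal_power2_le_imp_le) simp
  then have "epowr ?I (1 / p) \<le> epowr (ennreal (sqrt (X * Y) powr p)) (1 / p)"
    using p by (intro epowr_mono) auto
  also have "\<dots> = ennreal (sqrt (X * Y))"
    using p XY by (simp add: epowr_ennreal powr_powr)
  finally show ?thesis by (simp add: Lp_norm_def)
qed

theorem mainTheorem6:
  fixes r :: ereal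
  shows "\<exists>C::real. C > 0 \<and>
    (\<forall>p::real. 1 < p \<longrightarrow> ereal p \<le> r \<longrightarrow>
      (\<forall>F \<in> lorentz_space p r \<inter> BMO. \<forall>G \<in> lorentz_space p r \<inter> BMO.
        Lp_norm p (\<lambda>x :: real ^ 'n. F x * G x :: complex)
          \<le> ennreal (C * p\<^sup>2) *
              (lorentz_norm p r F * BMO_norm G + lorentz_norm p r G * BMO_norm F)))"
proof -
  define C where "C = 640 * decay_const DIM(real ^ 'n)"
  have C: "0 < C" unfolding C_def by (simp add: decay_const_def add_pos_pos)
  show ?thesis
  proof (intro exI[of _ C] conjI C allI impI ballI)
    fix p :: real and F G :: "real ^ 'n \<Rightarrow> complex"
    assume p: "1 < p" "ereal p \<le> r" and FG: "F \<in> lorentz_space p r \<inter> BMO" "G \<in> lorentz_space p r \<inter> BMO"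
    have real_norms: "\<exists>A a. 0 \<le> A \<and> 0 \<le> a \<and> lorentz_norm p r H = ennreal A \<and> BMO_norm H = ennreal a"
      if "H \<in> lorentz_space p r \<inter> BMO" for H :: "real ^ 'n \<Rightarrow> complex"
      using that by (cases "lorentz_norm p r H"; cases "BMO_norm H") (auto simp: lorentz_space_def BMO_def)
    obtain A a where A: "0 \<le> A" "0 \<le> a" "lorentz_norm p r F = ennreal A" "BMO_norm F = ennreal a"
      using real_norms[OF FG(1)] by blast
    obtain B b where B: "0 \<le> B" "0 \<le> b" "lorentz_norm p r G = ennreal B" "BMO_norm G = ennreal b"
      using real_norms[OF FG(2)] by blast
    have F: "F \<in> borel_measurable lebesgue" and G: "G \<in> borel_measurable lebesgue"
      using FG by (auto simp: lorentz_space_def)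
    have "Lp_norm p (\<lambda>x. F x * G x) \<le> ennreal (sqrt ((C * p\<^sup>2 * A * a) * (C * p\<^sup>2 * B * b)))"
    proof (rule Lp_norm_mult_le[OF F G])
      show "(\<integral>\<^sup>+x. ennreal (norm (F x) powr (2 * p)) \<partial>lebesgue) \<le> ennreal ((C * p\<^sup>2 * A * a) powr p)"
        using nn_integral_powr_double_le_lorentz_BMO[OF F _ p(2) A(3,1,4,2)] p(1) by (simp add: C_def)
      show "(\<integral>\<^sup>+x. ennreal (norm (G x) powr (2 * p)) \<partial>lebesgue) \<le> ennreal ((C * p\<^sup>2 * B * b) powr p)"
        using nn_integral_powr_double_le_lorentz_BMO[OF G _ p(2) B(3,1,4,2)] p(1) by (simp add: C_def)
    qed (use p C A B in auto)
    also have "sqrt ((C * p\<^sup>2 * A * a) * (C * p\<^sup>2 * B * b)) = C * p\<^sup>2 * sqrt ((A * b) * (B * a))"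
      using C by (intro real_sqrt_unique) (auto simp: power_mult_distrib power2_eq_square A B)
    also have "\<dots> \<le> C * p\<^sup>2 * (A * b + B * a)"
    proof -
      have "0 \<le> A * b" "0 \<le> B * a" using A B by auto
      then have "sqrt ((A * b) * (B * a)) \<le> (A * b + B * a) / 2" "(A * b + B * a) / 2 \<le> A * b + B * a"
        using arith_geo_mean_sqrt[of "A * b" "B * a"] by (blast, simp)
      then have "sqrt ((A * b) * (B * a)) \<le> A * b + B * a" by (rule order_trans)
      then show ?thesis using C by (intro mult_left_mono) auto
    qed
    then have "ennreal (C * p\<^sup>2 * sqrt ((A * b) * (B * a))) \<le> ennreal (C * p\<^sup>2 * (A * b + B * a))"
      by (rule ennreal_leI)
    also have "\<dots> = ennreal (C * p\<^sup>2) * (lorentz_norm p r F * BMO_norm G + lorentz_norm p r G * BMO_norm F)"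
    proof -
      have "ennreal (A * b + B * a) = ennreal A * ennreal b + ennreal B * ennreal a"
        using A B by (simp add: ennreal_mult)
      moreover have "ennreal (C * p\<^sup>2 * (A * b + B * a)) = ennreal (C * p\<^sup>2) * ennreal (A * b + B * a)"
        using C by (intro ennreal_mult') simp
      ultimately show ?thesis using A B by simp
    qed
    finally show "Lp_norm p (\<lambda>x. F x * G x) \<le> ennreal (C * p\<^sup>2) *
      (lorentz_norm p r F * BMO_norm G + lorentz_norm p r G * BMO_norm F)" .
  qed
qed

end
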